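(* Let $V$ be a finite-dimensional $\mathbb{Q}$-vector space, $F=1+D$ an automorphism of $V$ with $V[D^2]=V[D]$, and $(\cdot,\cdot):V\times V\to\mathbb{Q}$ an $F$-invariant non-degenerate symmetric pairing. Let $\Lambda\subset V$ be an $F$-stable full-rank lattice with $\Lambda^\vee\subseteq\Lambda$. Then $\mathfrak{B}_{\Lambda,\Lambda^\vee}$ admits a perfect antisymmetric pairing with values in $\mathbb{Q}/\mathbb{Z}$. Explicitly, $\langle x,y\rangle\equiv(x,(D|_{DV})^{-1}y)\bmod\mathbb{Z}$ defines a pairing $DV\times DV\to\mathbb{Q}/\mathbb{Z}$ which satisfies (i) $\langle x,y\rangle+\langle y,Fx\rangle=0$ for all $x,y\in DV$, and (ii) it passes to a perfect antisymmetric pairing on $\dfrac{\Lambda^\vee\cap DV}{\Lambda^\vee\cap D\Lambda}\cong\mathfrak{B}_{\Lambda,\Lambda^\vee}$.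
   Context: $V[D]=\ker D$; $\Lambda^\vee=\{v\in V:(v,\lambda)\in\mathbb{Z}\ \forall\lambda\in\Lambda\}$; $D^{-1}\Lambda^\vee=\{v\in V:Dv\in\Lambda^\vee\}$; $\mathfrak{B}_{\Lambda,\Lambda^\vee}=\dfrac{\Lambda+D^{-1}\Lambda^\vee}{\Lambda+V[D]}$. $D|_{DV}$ is invertible since $V=DV\oplus V[D]$. *)

theory Defs
  imports "HOL-Algebra.Coset" "HOL-Library.Set_Algebras" "HOL-Library.FuncSet" HOL.Vector_Spaces HOL.Rat
begin

definition additive_group :: "'a::ab_group_add set \<Rightarrow> 'a monoid" where
  "additive_group S = \<lparr>carrier = S, mult = (+), one = 0\<rparr>"

definition QZ :: "rat set monoid" where
  "QZ = additive_group (UNIV :: rat set) Mod \<int>"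

definition mod_Z :: "rat \<Rightarrow> rat set" where
  "mod_Z r = \<int> #>\<^bsub>additive_group UNIV\<^esub> r"

definition QZ_pairing :: "('g, 'm) monoid_scheme \<Rightarrow> ('g \<Rightarrow> 'g \<Rightarrow> rat set) \<Rightarrow> bool" where
  "QZ_pairing G b \<longleftrightarrow>
     (\<forall>x\<in>carrier G. (\<lambda>y. b x y) \<in> hom G QZ) \<and>
     (\<forall>y\<in>carrier G. (\<lambda>x. b x y) \<in> hom G QZ)"

(* Both induced maps G -> Hom(G, Q/Z) are bijective; restriction to the carrier
   makes each homomorphism a unique HOL function. *)
definition perfect_QZ_pairing :: "('g, 'm) monoid_scheme \<Rightarrow> ('g \<Rightarrow> 'g \<Rightarrow> rat set) \<Rightarrow> bool" where
  "perfect_QZ_pairing G b \<longleftrightarrow> QZ_pairing G b \<and>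
     bij_betw (\<lambda>x. \<lambda>y\<in>carrier G. b x y) (carrier G) (hom G QZ \<inter> extensional (carrier G)) \<and>
     bij_betw (\<lambda>y. \<lambda>x\<in>carrier G. b x y) (carrier G) (hom G QZ \<inter> extensional (carrier G))"

definition antisymmetric_QZ_pairing :: "('g, 'm) monoid_scheme \<Rightarrow> ('g \<Rightarrow> 'g \<Rightarrow> rat set) \<Rightarrow> bool" where
  "antisymmetric_QZ_pairing G b \<longleftrightarrow>
     (\<forall>x\<in>carrier G. \<forall>y\<in>carrier G. b x y = inv\<^bsub>QZ\<^esub> (b y x))"

definition nondegenerate_symmetric_pairing ::
  "(rat \<Rightarrow> 'v::ab_group_add \<Rightarrow> 'v) \<Rightarrow> ('v \<Rightarrow> 'v \<Rightarrow> rat) \<Rightarrow> bool" where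
  "nondegenerate_symmetric_pairing scale p \<longleftrightarrow>
     (\<forall>x. Vector_Spaces.linear scale (*) (\<lambda>y. p x y)) \<and>
     (\<forall>y. Vector_Spaces.linear scale (*) (\<lambda>x. p x y)) \<and>
     (\<forall>x y. p x y = p y x) \<and>
     (\<forall>x. (\<forall>y. p x y = 0) \<longrightarrow> x = 0)"

definition full_rank_lattice :: "(rat \<Rightarrow> 'v::ab_group_add \<Rightarrow> 'v) \<Rightarrow> 'v set \<Rightarrow> bool" where
  "full_rank_lattice scale \<Lambda> \<longleftrightarrow>
     (\<exists>E. finite E \<and> \<not> module.dependent scale E \<and> module.span scale E = UNIV \<and>
          \<Lambda> = {\<Sum>e\<in>E. scale (of_int (c e)) e | c :: 'v \<Rightarrow> int. True})"

definition dual_lattice :: "('v \<Rightarrow> 'v \<Rightarrow> rat) \<Rightarrow> 'v set \<Rightarrow> 'v set" where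
  "dual_lattice p \<Lambda> = {v. \<forall>l\<in>\<Lambda>. p v l \<in> \<int>}"

definition ker :: "('v \<Rightarrow> 'v::ab_group_add) \<Rightarrow> 'v set" where
  "ker D = {v. D v = 0}"

definition B_group :: "('v \<Rightarrow> 'v::ab_group_add) \<Rightarrow> 'v set \<Rightarrow> 'v set \<Rightarrow> 'v set monoid" where
  "B_group D \<Lambda> \<Lambda>' = additive_group (\<Lambda> + D -` \<Lambda>') Mod (\<Lambda> + ker D)"

definition B_coset :: "('v \<Rightarrow> 'v::ab_group_add) \<Rightarrow> 'v set \<Rightarrow> 'v set \<Rightarrow> 'v \<Rightarrow> 'v set" where
  "B_coset D \<Lambda> \<Lambda>' v = (\<Lambda> + ker D) #>\<^bsub>additive_group (\<Lambda> + D -` \<Lambda>')\<^esub> v"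

definition image_quotient :: "('v \<Rightarrow> 'v::ab_group_add) \<Rightarrow> 'v set \<Rightarrow> 'v set \<Rightarrow> 'v set monoid" where
  "image_quotient D \<Lambda> \<Lambda>' = additive_group (\<Lambda>' \<inter> range D) Mod (\<Lambda>' \<inter> D ` \<Lambda>)"

definition image_coset :: "('v \<Rightarrow> 'v::ab_group_add) \<Rightarrow> 'v set \<Rightarrow> 'v set \<Rightarrow> 'v \<Rightarrow> 'v set" where
  "image_coset D \<Lambda> \<Lambda>' x = (\<Lambda>' \<inter> D ` \<Lambda>) #>\<^bsub>additive_group (\<Lambda>' \<inter> range D)\<^esub> x"

(* inv_into (range D) D is the inverse of the restriction of D to its image,
   meaningful when that restriction is a bijection of range D. *)
definition D_pairing ::
  "('v \<Rightarrow> 'v) \<Rightarrow> ('v \<Rightarrow> 'v \<Rightarrow> rat) \<Rightarrow> 'v \<Rightarrow> 'v \<Rightarrow> rat set" where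
  "D_pairing D p x y = mod_Z (p x (inv_into (range D) D y))"

end

theory Submission
  imports Defs "HOL-Library.Product_Plus"
begin

text \<open>
  Isometry makes \<open>DV\<close> orthogonal to \<open>ker D\<close>, so \<open>(x, D\<inverse> y)\<close> may be computed with any preimage
  of \<open>y\<close>, and expanding \<open>D = F - 1\<close> gives (i). On \<open>M = \<Lambda>\<^sup>\<or> \<inter> DV\<close> the correction term
  \<open>\<langle>y, D x\<rangle> = (y, x)\<close> in (i) is an integer, whence antisymmetry.

  For perfectness, a character of a subgroup of \<open>\<Lambda>\<close> extends to \<open>\<Lambda>\<close> one basis vector at a time and
  is then \<open>(\<cdot>, u)\<close> modulo integers for some \<open>u \<in> V\<close>. A character of \<open>M / (\<Lambda>\<^sup>\<or> \<inter> D\<Lambda>)\<close> is first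
  extended by \<open>0\<close> to \<open>M + D\<Lambda>\<close>; vanishing on \<open>D\<Lambda>\<close> means that \<open>w = F\<inverse> u\<close> satisfies
  \<open>D w \<in> \<Lambda>\<^sup>\<or>\<close>, and \<open>(x, u) \<equiv> (x, w) \<equiv> \<langle>x, D w\<rangle>\<close> for \<open>x \<in> M\<close> because \<open>\<Lambda>\<^sup>\<or> \<subseteq> \<Lambda>\<close>. This gives
  surjectivity. Applied to a character of \<open>D\<Lambda> + \<int> x\<close> that kills \<open>D\<Lambda>\<close> but not \<open>x\<close>, the same
  argument gives injectivity.
\<close>

section \<open>Subgroups and quotients of additive groups\<close>

text \<open>The one-step subgroup criterion, stated for bare sets. It serves uniformly for subsets
  of \<open>V\<close>, of the integers and of \<open>V \<times> \<rat>\<close>, where the graphs of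
  characters live.\<close>

definition add_subgroup :: "'a::ab_group_add set \<Rightarrow> bool" where
  "add_subgroup S \<longleftrightarrow> 0 \<in> S \<and> (\<forall>x\<in>S. \<forall>y\<in>S. x - y \<in> S)"

lemma add_subgroupI:
  assumes "0 \<in> S" "\<And>x y. x \<in> S \<Longrightarrow> y \<in> S \<Longrightarrow> x - y \<in> S"
  shows "add_subgroup S"
  using assms by (simp add: add_subgroup_def)

lemma add_subgroup_zero: "add_subgroup S \<Longrightarrow> 0 \<in> S"
  by (simp add: add_subgroup_def)

lemma add_subgroup_diff: "add_subgroup S \<Longrightarrow> x \<in> S \<Longrightarrow> y \<in> S \<Longrightarrow> x - y \<in> S"
  by (simp add: add_subgroup_def)

lemma add_subgroup_minus: "add_subgroup S \<Longrightarrow> x \<in> S \<Longrightarrow> - x \<in> S"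
  using add_subgroup_diff[of S 0 x] by (simp add: add_subgroup_zero)

lemma add_subgroup_add: "add_subgroup S \<Longrightarrow> x \<in> S \<Longrightarrow> y \<in> S \<Longrightarrow> x + y \<in> S"
  using add_subgroup_diff[of S x "- y"] by (simp add: add_subgroup_minus)

lemma add_subgroup_sum:
  assumes "add_subgroup S" "\<And>i. i \<in> I \<Longrightarrow> f i \<in> S"
  shows "sum f I \<in> S"
  using assms(2)
  by (induction I rule: infinite_finite_induct)
    (auto simp: add_subgroup_zero[OF assms(1)] add_subgroup_add[OF assms(1)])

lemma add_subgroup_Int: "add_subgroup S \<Longrightarrow> add_subgroup T \<Longrightarrow> add_subgroup (S \<inter> T)"
  by (simp add: add_subgroup_def)

lemma add_subgroup_plus:
  assumes "add_subgroup S" "add_subgroup T"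
  shows "add_subgroup (S + T)"
proof (rule add_subgroupI)
  show "0 \<in> S + T"
    using set_plus_intro[of 0 S 0 T] assms by (simp add: add_subgroup_zero)
  fix x y assume "x \<in> S + T" "y \<in> S + T"
  then obtain s t s' t' where *: "x = s + t" "y = s' + t'" "s \<in> S" "t \<in> T" "s' \<in> S" "t' \<in> T"
    by (auto elim!: set_plus_elim)
  have "(s - s') + (t - t') \<in> S + T"
    using * assms by (intro set_plus_intro add_subgroup_diff)
  then show "x - y \<in> S + T" by (simp add: * algebra_simps)
qed

lemma add_subgroup_image:
  assumes "additive f" "add_subgroup S"
  shows "add_subgroup (f ` S)"
proof (rule add_subgroupI)
  show "0 \<in> f ` S"
    using imageI[OF add_subgroup_zero[OF assms(2)], of f] by (simp add: additive.zero[OF assms(1)])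
  fix x y assume "x \<in> f ` S" "y \<in> f ` S"
  then obtain u v where "u \<in> S" "v \<in> S" "x = f u" "y = f v" by blast
  then show "x - y \<in> f ` S"
    using imageI[OF add_subgroup_diff[OF assms(2), of u v], of f] by (simp add: additive.diff[OF assms(1)])
qed

lemma add_subgroup_vimage:
  assumes "additive f" "add_subgroup S"
  shows "add_subgroup (f -` S)"
  using assms by (auto simp: add_subgroup_def additive.zero additive.diff)

lemma add_subgroup_Ints: "add_subgroup (\<int> :: 'a::ring_1 set)"
  by (simp add: add_subgroup_def)

text \<open>Division with remainder: the generator is the least positive element, or
  \<open>0\<close> for the trivial subgroup. It is applied to the set of \<open>k\<close> with
  \<open>k x\<close> in a given subgroup, so \<open>n\<close> is the order of \<open>x\<close>
  modulo that subgroup, and \<open>n = 0\<close> encodes infinite order.\<close>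

lemma add_subgroup_int_principal:
  fixes I :: "int set"
  assumes "add_subgroup I"
  obtains n where "n \<ge> 0" "n \<in> I" "\<forall>k\<in>I. n dvd k"
proof (cases "I \<subseteq> {0}")
  case True
  then show ?thesis using that[of 0] add_subgroup_zero[OF assms] by auto
next
  case False
  then obtain k where k: "k \<in> I" "k \<noteq> 0" by blast
  then have "\<bar>k\<bar> \<in> I" using add_subgroup_minus[OF assms] by (simp add: abs_if)
  then have ex: "\<exists>m::nat. m > 0 \<and> int m \<in> I" using k(2) by (intro exI[of _ "nat \<bar>k\<bar>"]) auto
  define m where "m = (LEAST m::nat. m > 0 \<and> int m \<in> I)"
  have m: "m > 0" "int m \<in> I" using LeastI_ex[OF ex] by (auto simp: m_def)
  have least: "m \<le> j" if "j > 0" "int j \<in> I" for j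
    unfolding m_def by (rule Least_le) (use that in simp)
  have mult: "int m * int j \<in> I" for j
    by (induction j) (auto simp: add_subgroup_zero[OF assms] algebra_simps
        intro!: add_subgroup_add[OF assms] m)
  have mult': "int m * j \<in> I" for j
    using mult[of "nat \<bar>j\<bar>"] add_subgroup_minus[OF assms, of "int m * int (nat \<bar>j\<bar>)"]
    by (auto simp: abs_if split: if_splits)
  have "int m dvd i" if i: "i \<in> I" for i
  proof (rule ccontr)
    assume ndvd: "\<not> int m dvd i"
    have pos: "i mod int m > 0"
      using ndvd m(1) pos_mod_sign[of "int m" i] by (simp add: dvd_eq_mod_eq_0 del: pos_mod_sign)
    have "i mod int m = i - int m * (i div int m)" by (simp add: minus_mult_div_eq_mod)
    then have "i mod int m \<in> I" using add_subgroup_diff[OF assms i mult'] by simp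
    then have "m \<le> nat (i mod int m)"
      using pos by (intro least) auto
    moreover have "i mod int m < int m" using m(1) by simp
    ultimately show False using pos by linarith
  qed
  then show ?thesis using that[of "int m"] m by auto
qed

section \<open>Additive groups as monoid records and their coset groups\<close>

lemma carrier_additive_group [simp]: "carrier (additive_group S) = S"
  and mult_additive_group [simp]: "x \<otimes>\<^bsub>additive_group S\<^esub> y = x + y"
  and one_additive_group [simp]: "\<one>\<^bsub>additive_group S\<^esub> = 0"
  by (simp_all add: additive_group_def)

lemma comm_group_additive_group:
  assumes "add_subgroup S"
  shows "comm_group (additive_group S)"
proof (rule comm_groupI)
  fix x assume "x \<in> carrier (additive_group S)"
  then show "\<exists>y\<in>carrier (additive_group S). y \<otimes>\<^bsub>additive_group S\<^esub> x = \<one>\<^bsub>additive_group S\<^esub>"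
    using add_subgroup_minus[OF assms] by (intro bexI[of _ "- x"]) auto
qed (auto simp: add_subgroup_add[OF assms] add_subgroup_zero[OF assms] algebra_simps)

lemma inv_additive_group:
  assumes "add_subgroup S" "x \<in> S"
  shows "inv\<^bsub>additive_group S\<^esub> x = - x"
proof -
  interpret comm_group "additive_group S" using assms(1) by (rule comm_group_additive_group)
  show ?thesis
    using assms by (intro inv_equality) (auto simp: add_subgroup_minus)
qed

lemma normal_additive_group:
  assumes "add_subgroup S" "add_subgroup N" "N \<subseteq> S"
  shows "N \<lhd> additive_group S"
proof -
  interpret comm_group "additive_group S" using assms(1) by (rule comm_group_additive_group)
  have "subgroup N (additive_group S)"
    by (rule subgroupI) (use assms in \<open>auto simp: inv_additive_group add_subgroup_add
        add_subgroup_minus subset_iff intro: add_subgroup_zero\<close>)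
  then show ?thesis by (rule subgroup_imp_normal)
qed

lemma carrier_additive_Mod:
  "carrier (additive_group S Mod N) = (\<lambda>x. N #>\<^bsub>additive_group S\<^esub> x) ` S"
  by (simp add: carrier_FactGroup)

text \<open>A coset is computed from addition alone, so the same criterion covers cosets taken in
  any \<open>S\<close>, in particular the classes \<open>mod_Z r\<close>.\<close>

lemma additive_coset_eq_iff:
  assumes "add_subgroup N"
  shows "N #>\<^bsub>additive_group S\<^esub> x = N #>\<^bsub>additive_group S\<^esub> y \<longleftrightarrow> x - y \<in> N"
proof
  assume "N #>\<^bsub>additive_group S\<^esub> x = N #>\<^bsub>additive_group S\<^esub> y"
  moreover have "x \<in> N #>\<^bsub>additive_group S\<^esub> x"
    using add_subgroup_zero[OF assms] by (auto simp: r_coset_def intro!: bexI[of _ 0])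
  ultimately show "x - y \<in> N" by (auto simp: r_coset_def)
next
  have sub: "N #>\<^bsub>additive_group S\<^esub> x \<subseteq> N #>\<^bsub>additive_group S\<^esub> y" if "x - y \<in> N" for x y
  proof -
    have "n + x \<in> N #>\<^bsub>additive_group S\<^esub> y" if n: "n \<in> N" for n
      using add_subgroup_add[OF assms n \<open>x - y \<in> N\<close>]
      by (auto simp: r_coset_def algebra_simps intro!: bexI[of _ "n + (x - y)"])
    then show ?thesis by (auto simp: r_coset_def)
  qed
  assume "x - y \<in> N"
  moreover from this have "y - x \<in> N" using add_subgroup_minus[OF assms] by fastforce
  ultimately show "N #>\<^bsub>additive_group S\<^esub> x = N #>\<^bsub>additive_group S\<^esub> y"
    using sub by blast
qed

lemma additive_Mod_mult:
  assumes "add_subgroup S" "add_subgroup N" "N \<subseteq> S" "x \<in> S" "y \<in> S"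
  shows "(N #>\<^bsub>additive_group S\<^esub> x) \<otimes>\<^bsub>additive_group S Mod N\<^esub> (N #>\<^bsub>additive_group S\<^esub> y)
    = N #>\<^bsub>additive_group S\<^esub> (x + y)"
  using normal.rcos_sum[OF normal_additive_group[OF assms(1-3)]] assms(4,5) by simp

lemma group_additive_Mod:
  assumes "add_subgroup S" "add_subgroup N" "N \<subseteq> S"
  shows "group (additive_group S Mod N)"
  using normal.factorgroup_is_group[OF normal_additive_group[OF assms]] .

text \<open>The second and first isomorphism theorems in one step: \<open>S / P\<close> is
  \<open>U / (U \<inter> P)\<close> because \<open>U\<close> meets every coset of \<open>P\<close>,
  and \<open>f\<close> carries the latter isomorphically to \<open>f(U) / N\<close> because
  \<open>U \<inter> P\<close> is the preimage of \<open>N\<close> in \<open>U\<close>.\<close>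

lemma additive_Mod_iso:
  assumes S: "add_subgroup S" and P: "add_subgroup P" "P \<subseteq> S"
    and N: "add_subgroup N" "N \<subseteq> f ` U"
    and U: "add_subgroup U" "U \<subseteq> S" "\<And>s. s \<in> S \<Longrightarrow> \<exists>u\<in>U. s - u \<in> P"
    and f: "additive f" and iff: "\<And>u. u \<in> U \<Longrightarrow> u \<in> P \<longleftrightarrow> f u \<in> N"
  obtains \<phi> where "\<phi> \<in> iso (additive_group S Mod P) (additive_group (f ` U) Mod N)"
    "\<forall>u\<in>U. \<phi> (P #>\<^bsub>additive_group S\<^esub> u) = N #>\<^bsub>additive_group (f ` U)\<^esub> f u"
proof -
  let ?c = "\<lambda>s. P #>\<^bsub>additive_group S\<^esub> s"
  let ?d = "\<lambda>x. N #>\<^bsub>additive_group (f ` U)\<^esub> x"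
  \<comment> \<open>A coset is evaluated at a chosen representative inside \<open>U\<close>. The
    fact \<open>eq\<close> below gives both independence of the choice and injectivity.\<close>
  define \<phi> where "\<phi> X = ?d (f (SOME u. u \<in> U \<and> X = ?c u))" for X
  have fU: "add_subgroup (f ` U)" using f U(1) by (rule add_subgroup_image)
  have eq: "?c u = ?c v \<longleftrightarrow> ?d (f u) = ?d (f v)" if "u \<in> U" "v \<in> U" for u v
    using iff[OF add_subgroup_diff[OF U(1) that]]
    by (simp add: additive_coset_eq_iff P N additive.diff[OF f])
  have \<phi>: "\<phi> (?c u) = ?d (f u)" if "u \<in> U" for u
  proof -
    have "(SOME v. v \<in> U \<and> ?c u = ?c v) \<in> U \<and> ?c u = ?c (SOME v. v \<in> U \<and> ?c u = ?c v)"
      using someI[of "\<lambda>v. v \<in> U \<and> ?c u = ?c v" u] that by blast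
    then show ?thesis unfolding \<phi>_def using eq that by metis
  qed
  have car: "carrier (additive_group S Mod P) = ?c ` U"
  proof -
    have "?c s \<in> ?c ` U" if s: "s \<in> S" for s
    proof -
      obtain u where "u \<in> U" "s - u \<in> P" using U(3)[OF s] by blast
      then show ?thesis using additive_coset_eq_iff[OF P(1), of S s u] by blast
    qed
    then show ?thesis unfolding carrier_additive_Mod using U(2) by blast
  qed
  have car': "carrier (additive_group (f ` U) Mod N) = (\<lambda>u. ?d (f u)) ` U"
    by (auto simp: carrier_additive_Mod)
  have "\<phi> \<in> hom (additive_group S Mod P) (additive_group (f ` U) Mod N)"
  proof (rule homI)
    fix X assume "X \<in> carrier (additive_group S Mod P)"
    then show "\<phi> X \<in> carrier (additive_group (f ` U) Mod N)" by (auto simp: car car' \<phi>)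
  next
    fix X Y assume "X \<in> carrier (additive_group S Mod P)" "Y \<in> carrier (additive_group S Mod P)"
    then obtain u v where uv: "u \<in> U" "v \<in> U" "X = ?c u" "Y = ?c v" by (auto simp: car)
    have "X \<otimes>\<^bsub>additive_group S Mod P\<^esub> Y = ?c (u + v)"
      using uv U(2) by (simp only: additive_Mod_mult[OF S P] subsetD)
    moreover have "\<phi> X \<otimes>\<^bsub>additive_group (f ` U) Mod N\<^esub> \<phi> Y = ?d (f (u + v))"
      using uv by (simp only: \<phi> additive.add[OF f] additive_Mod_mult[OF fU N] imageI)
    ultimately show "\<phi> (X \<otimes>\<^bsub>additive_group S Mod P\<^esub> Y)
        = \<phi> X \<otimes>\<^bsub>additive_group (f ` U) Mod N\<^esub> \<phi> Y"
      using \<phi>[OF add_subgroup_add[OF U(1) uv(1,2)]] by (simp only:)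
  qed
  moreover have "bij_betw \<phi> (carrier (additive_group S Mod P)) (carrier (additive_group (f ` U) Mod N))"
    unfolding bij_betw_def
  proof
    show "inj_on \<phi> (carrier (additive_group S Mod P))"
    proof (rule inj_onI)
      fix X Y assume "X \<in> carrier (additive_group S Mod P)" "Y \<in> carrier (additive_group S Mod P)"
        "\<phi> X = \<phi> Y"
      moreover from this obtain u v where "u \<in> U" "v \<in> U" "X = ?c u" "Y = ?c v" by (auto simp: car)
      ultimately show "X = Y" by (simp only: \<phi> eq)
    qed
    show "\<phi> ` carrier (additive_group S Mod P) = carrier (additive_group (f ` U) Mod N)"
      unfolding car car' image_image using \<phi> by (rule image_cong[OF refl])
  qed
  ultimately show ?thesis using that \<phi> by (auto simp: iso_def)
qed

section \<open>Perfect pairings with values in rationals modulo integers\<close>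

lemma carrier_QZ: "carrier QZ = range mod_Z"
  by (simp add: QZ_def mod_Z_def[abs_def] carrier_FactGroup)

lemma mod_Z_eq_iff: "mod_Z r = mod_Z s \<longleftrightarrow> r - s \<in> \<int>"
  unfolding mod_Z_def by (rule additive_coset_eq_iff) (rule add_subgroup_Ints)

lemma mult_QZ: "mod_Z r \<otimes>\<^bsub>QZ\<^esub> mod_Z s = mod_Z (r + s)"
  unfolding mod_Z_def QZ_def
  by (rule additive_Mod_mult) (auto simp: add_subgroup_Ints, simp add: add_subgroup_def)

lemma group_QZ: "group QZ"
  unfolding QZ_def by (rule group_additive_Mod) (auto simp: add_subgroup_Ints, simp add: add_subgroup_def)

lemma one_QZ: "\<one>\<^bsub>QZ\<^esub> = mod_Z 0"
  by (auto simp: QZ_def mod_Z_def r_coset_def)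

lemma inv_QZ: "inv\<^bsub>QZ\<^esub> (mod_Z r) = mod_Z (- r)"
  by (rule group.inv_equality[OF group_QZ]) (auto simp: mult_QZ one_QZ carrier_QZ)

text \<open>Precomposition with \<open>\<phi>\<close> identifies the characters of \<open>H\<close>
  with those of \<open>G\<close>, so bijectivity onto the character group is transported.\<close>

lemma perfect_QZ_pairing_iso:
  assumes G: "group G" and H: "group H" and \<phi>: "\<phi> \<in> iso G H" and b: "perfect_QZ_pairing H b"
  shows "perfect_QZ_pairing G (\<lambda>x y. b (\<phi> x) (\<phi> y))"
proof -
  have hom: "\<phi> \<in> hom G H" and bij: "bij_betw \<phi> (carrier G) (carrier H)"
    using \<phi> by (auto simp: iso_def)
  have clo: "\<phi> x \<in> carrier H" if "x \<in> carrier G" for x using that hom by (rule hom_in_carrier[rotated])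
  define \<psi> where "\<psi> = inv_into (carrier G) \<phi>"
  have \<psi>: "\<psi> \<in> hom H G"
    using group.iso_set_sym[OF G \<phi>] by (auto simp: iso_def \<psi>_def)
  have \<psi>\<phi>: "\<psi> (\<phi> x) = x" if "x \<in> carrier G" for x
    using that bij by (simp add: \<psi>_def bij_betw_inv_into_left)
  have \<phi>\<psi>: "\<phi> (\<psi> y) = y" if "y \<in> carrier H" for y
    using that bij by (simp add: \<psi>_def bij_betw_inv_into_right)
  have comp: "(\<lambda>x. \<chi> (\<phi> x)) \<in> hom G QZ" if "\<chi> \<in> hom H QZ" for \<chi>
    using hom_compose[OF hom that] by (simp add: o_def)
  \<comment> \<open>The claim is made for an arbitrary \<open>c\<close> so that it applies both to
    \<open>b\<close> and to \<open>b\<close> with its arguments exchanged.\<close>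
  have main: "bij_betw (\<lambda>x. \<lambda>y\<in>carrier G. c (\<phi> x) (\<phi> y)) (carrier G) (hom G QZ \<inter> extensional (carrier G))"
    if c: "bij_betw (\<lambda>x. \<lambda>y\<in>carrier H. c x y) (carrier H) (hom H QZ \<inter> extensional (carrier H))" for c
  proof -
    let ?T = "\<lambda>\<chi>. \<lambda>y\<in>carrier G. \<chi> (\<phi> y)"
    have "bij_betw ?T (hom H QZ \<inter> extensional (carrier H)) (hom G QZ \<inter> extensional (carrier G))"
    proof (rule bij_betw_byWitness[where f' = "\<lambda>\<chi>. \<lambda>y\<in>carrier H. \<chi> (\<psi> y)"])
      show "\<forall>a\<in>hom H QZ \<inter> extensional (carrier H). (\<lambda>y\<in>carrier H. ?T a (\<psi> y)) = a"
      proof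
        fix a assume a: "a \<in> hom H QZ \<inter> extensional (carrier H)"
        show "(\<lambda>y\<in>carrier H. ?T a (\<psi> y)) = a"
          by (rule extensionalityI[where A = "carrier H"]) (use a hom_in_carrier[OF \<psi>] in \<open>auto simp: \<phi>\<psi>\<close>)
      qed
      show "\<forall>a\<in>hom G QZ \<inter> extensional (carrier G). ?T (\<lambda>y\<in>carrier H. a (\<psi> y)) = a"
      proof
        fix a assume a: "a \<in> hom G QZ \<inter> extensional (carrier G)"
        show "?T (\<lambda>y\<in>carrier H. a (\<psi> y)) = a"
          by (rule extensionalityI[where A = "carrier G"]) (use a clo in \<open>auto simp: \<psi>\<phi>\<close>)
      qed
      have res: "restrict a (carrier K) \<in> hom K QZ" if "a \<in> hom K QZ" "group K"
        for a and K :: "('z, 'y) monoid_scheme"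
        using that by (auto simp: hom_def group.is_monoid monoid.m_closed)
      show "?T ` (hom H QZ \<inter> extensional (carrier H)) \<subseteq> hom G QZ \<inter> extensional (carrier G)"
        using res[OF comp G] by auto
      have "(\<lambda>y. a (\<psi> y)) \<in> hom H QZ" if "a \<in> hom G QZ" for a
        using hom_compose[OF \<psi> that] by (simp add: o_def)
      then show "(\<lambda>a. \<lambda>y\<in>carrier H. a (\<psi> y)) ` (hom G QZ \<inter> extensional (carrier G))
          \<subseteq> hom H QZ \<inter> extensional (carrier H)"
        using res[OF _ H] by auto
    qed
    from bij_betw_trans[OF bij_betw_trans[OF bij c] this] show ?thesis
      by (rule bij_betw_cong[THEN iffD1, rotated]) (auto simp: fun_eq_iff clo)
  qed
  show ?thesis
    using b unfolding perfect_QZ_pairing_def QZ_pairing_def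
    using main[of b] main[of "\<lambda>x y. b y x"] comp clo by auto
qed

text \<open>A pairing on a subgroup \<open>M\<close> is given by rational representatives \<open>\<beta> x y\<close>; a character of
  \<open>M / N\<close> likewise by a function \<open>g\<close> that is additive on \<open>M\<close> modulo integers.\<close>

lemma additive_Mod_perfect_pairing:
  assumes M: "add_subgroup M" and N: "add_subgroup N" "N \<subseteq> M"
    and add: "\<And>x y z. x \<in> M \<Longrightarrow> y \<in> M \<Longrightarrow> z \<in> M \<Longrightarrow> \<beta> x (y + z) = \<beta> x y + \<beta> x z"
    and anti: "\<And>x y. x \<in> M \<Longrightarrow> y \<in> M \<Longrightarrow> \<beta> x y + \<beta> y x \<in> \<int>"
    and int: "\<And>x y. x \<in> M \<Longrightarrow> y \<in> N \<Longrightarrow> \<beta> x y \<in> \<int>"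
    and sep: "\<And>x. x \<in> M \<Longrightarrow> x \<notin> N \<Longrightarrow> \<exists>y\<in>M. \<beta> x y \<notin> \<int>"
    and rep: "\<And>g. (\<And>x y. x \<in> M \<Longrightarrow> y \<in> M \<Longrightarrow> g (x + y) - (g x + g y) \<in> \<int>) \<Longrightarrow>
        (\<And>x. x \<in> N \<Longrightarrow> g x \<in> \<int>) \<Longrightarrow> \<exists>y\<in>M. \<forall>x\<in>M. g x - \<beta> x y \<in> \<int>"
  obtains b where
    "\<forall>x\<in>M. \<forall>y\<in>M.
      b (N #>\<^bsub>additive_group M\<^esub> x) (N #>\<^bsub>additive_group M\<^esub> y) = mod_Z (\<beta> x y)"
    "perfect_QZ_pairing (additive_group M Mod N) b"
    "antisymmetric_QZ_pairing (additive_group M Mod N) b"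
proof -
  let ?G = "additive_group M Mod N"
  let ?c = "\<lambda>x. N #>\<^bsub>additive_group M\<^esub> x"
  have G: "group ?G" using M N by (rule group_additive_Mod)
  have car: "carrier ?G = ?c ` M" by (rule carrier_additive_Mod)
  have c_eq: "?c x = ?c y \<longleftrightarrow> x - y \<in> N" for x y using N(1) by (rule additive_coset_eq_iff)
  have c_add: "?c x \<otimes>\<^bsub>?G\<^esub> ?c y = ?c (x + y)" if "x \<in> M" "y \<in> M" for x y
    using M N that by (rule additive_Mod_mult)
  have anti': "mod_Z (\<beta> x y) = mod_Z (- \<beta> y x)" if "x \<in> M" "y \<in> M" for x y
    using anti[OF that] by (simp add: mod_Z_eq_iff)
  have cong2: "mod_Z (\<beta> x y) = mod_Z (\<beta> x y')" if "x \<in> M" "y \<in> M" "y' \<in> M" "?c y = ?c y'" for x y y'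
  proof -
    have d: "y - y' \<in> N" using that(4) by (simp only: c_eq)
    have "\<beta> x y = \<beta> x (y - y') + \<beta> x y'" using add[OF that(1) _ that(3), of "y - y'"] d N(2) by auto
    then show ?thesis using int[OF that(1) d] by (simp add: mod_Z_eq_iff)
  qed
  have neg: "mod_Z (- r) = mod_Z (- s)" if "mod_Z r = mod_Z s" for r s
    using that Ints_minus[of "r - s"] by (simp add: mod_Z_eq_iff)
  \<comment> \<open>Antisymmetry modulo integers moves the first argument into the second, where
    additivity and integrality on \<open>N\<close> are available.\<close>
  have cong1: "mod_Z (\<beta> x y) = mod_Z (\<beta> x' y)" if "x \<in> M" "x' \<in> M" "y \<in> M" "?c x = ?c x'" for x x' y
    using neg[OF cong2[OF that(3,1,2,4)]] anti' that by simp
  define r where "r X = (SOME x. x \<in> M \<and> X = ?c x)" for X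
  have r: "r (?c x) \<in> M" "?c x = ?c (r (?c x))" if "x \<in> M" for x
    using someI[of "\<lambda>v. v \<in> M \<and> ?c x = ?c v" x] that unfolding r_def by blast+
  define b where "b X Y = mod_Z (\<beta> (r X) (r Y))" for X Y
  have b: "b (?c x) (?c y) = mod_Z (\<beta> x y)" if "x \<in> M" "y \<in> M" for x y
  proof -
    have "b (?c x) (?c y) = mod_Z (\<beta> (r (?c x)) y)"
      unfolding b_def by (rule cong2) (use r that in auto)
    also have "\<dots> = mod_Z (\<beta> x y)" by (rule cong1) (use r that in auto)
    finally show ?thesis .
  qed
  have b_anti: "b X Y = inv\<^bsub>QZ\<^esub> (b Y X)" if "X \<in> carrier ?G" "Y \<in> carrier ?G" for X Y
    using that anti' by (auto simp: car b inv_QZ)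
  have hom2: "(\<lambda>Y. b X Y) \<in> hom ?G QZ" if "X \<in> carrier ?G" for X
  proof (rule homI)
    fix Y assume "Y \<in> carrier ?G"
    then show "b X Y \<in> carrier QZ" by (auto simp: b_def carrier_QZ)
  next
    fix Y Z assume "Y \<in> carrier ?G" "Z \<in> carrier ?G"
    with that obtain x y z where *: "x \<in> M" "y \<in> M" "z \<in> M" "X = ?c x" "Y = ?c y" "Z = ?c z"
      by (auto simp: car)
    then have "b X (Y \<otimes>\<^bsub>?G\<^esub> Z) = mod_Z (\<beta> x (y + z))"
      by (simp only: c_add b add_subgroup_add[OF M])
    then show "b X (Y \<otimes>\<^bsub>?G\<^esub> Z) = b X Y \<otimes>\<^bsub>QZ\<^esub> b X Z"
      using * by (simp only: b mult_QZ add)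
  qed
  have hom1: "(\<lambda>X. b X Y) \<in> hom ?G QZ" if "Y \<in> carrier ?G" for Y
  proof (rule homI)
    fix X assume "X \<in> carrier ?G"
    then show "b X Y \<in> carrier QZ" by (auto simp: b_def carrier_QZ)
  next
    fix X Z assume "X \<in> carrier ?G" "Z \<in> carrier ?G"
    with that obtain x y z where *: "x \<in> M" "y \<in> M" "z \<in> M" "X = ?c x" "Y = ?c y" "Z = ?c z"
      by (auto simp: car)
    then have "b (X \<otimes>\<^bsub>?G\<^esub> Z) Y = mod_Z (\<beta> (x + z) y)"
      by (simp only: c_add b add_subgroup_add[OF M])
    then show "b (X \<otimes>\<^bsub>?G\<^esub> Z) Y = b X Y \<otimes>\<^bsub>QZ\<^esub> b Z Y"
      using * by (simp add: b mult_QZ add anti' add_subgroup_add[OF M])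
  qed
  have inj: "x - x' \<in> N" if x: "x \<in> M" "x' \<in> M" and eq: "\<And>y. y \<in> M \<Longrightarrow> mod_Z (\<beta> y x) = mod_Z (\<beta> y x')" for x x'
  proof (rule ccontr)
    assume "x - x' \<notin> N"
    then obtain y where y: "y \<in> M" "\<beta> (x - x') y \<notin> \<int>" using sep add_subgroup_diff[OF M x] by blast
    have "\<beta> y x = \<beta> y (x - x') + \<beta> y x'"
      using add[OF y(1) add_subgroup_diff[OF M x] x(2)] by simp
    then have "\<beta> y (x - x') \<in> \<int>" using eq[OF y(1)] by (simp add: mod_Z_eq_iff)
    then show False
      using anti[OF y(1) add_subgroup_diff[OF M x]] y(2) Ints_diff by fastforce
  qed
  have surj: "\<exists>Y\<in>carrier ?G. \<forall>X\<in>carrier ?G. \<chi> X = b X Y" if \<chi>: "\<chi> \<in> hom ?G QZ" for \<chi>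
  proof -
    \<comment> \<open>The character is lifted to a rational-valued function \<open>g\<close> on
      \<open>M\<close>. The choice of lifts makes \<open>g\<close> additive only up to integers,
      which is exactly what \<open>rep\<close> accepts.\<close>
    have "\<exists>q. \<chi> (?c x) = mod_Z q" if "x \<in> M" for x
      using hom_in_carrier[OF \<chi>, of "?c x"] that by (auto simp: car carrier_QZ)
    then obtain g where g: "\<And>x. x \<in> M \<Longrightarrow> \<chi> (?c x) = mod_Z (g x)" by metis
    have "\<exists>y\<in>M. \<forall>x\<in>M. g x - \<beta> x y \<in> \<int>"
    proof (rule rep)
      fix x y assume xy: "x \<in> M" "y \<in> M"
      have "mod_Z (g (x + y)) = \<chi> (?c x \<otimes>\<^bsub>?G\<^esub> ?c y)"
        using xy by (simp only: g c_add add_subgroup_add[OF M])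
      also have "\<dots> = mod_Z (g x + g y)"
        using hom_mult[OF \<chi>, of "?c x" "?c y"] xy by (simp only: car imageI g mult_QZ)
      finally show "g (x + y) - (g x + g y) \<in> \<int>" by (simp add: mod_Z_eq_iff)
    next
      fix x assume x: "x \<in> N"
      have "?c x = \<one>\<^bsub>?G\<^esub>" using c_eq[of x 0] x by (auto simp: r_coset_def)
      then have "mod_Z (g x) = mod_Z 0"
        using hom_one[OF \<chi> G group_QZ] g[of x] x N(2) by (auto simp: one_QZ)
      then show "g x \<in> \<int>" by (simp add: mod_Z_eq_iff)
    qed
    then obtain y where y: "y \<in> M" "\<And>x. x \<in> M \<Longrightarrow> g x - \<beta> x y \<in> \<int>" by blast
    show ?thesis
      by (rule bexI[of _ "?c y"]) (use y in \<open>auto simp: car g b mod_Z_eq_iff\<close>)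
  qed
  have res: "restrict \<chi> (carrier ?G) \<in> hom ?G QZ \<inter> extensional (carrier ?G)" if "\<chi> \<in> hom ?G QZ" for \<chi>
    using that G by (auto simp: hom_def group.is_monoid monoid.m_closed simp del: mult_FactGroup)
  have "bij_betw (\<lambda>Y. \<lambda>X\<in>carrier ?G. b X Y) (carrier ?G) (hom ?G QZ \<inter> extensional (carrier ?G))"
    unfolding bij_betw_def
  proof
    show "inj_on (\<lambda>Y. \<lambda>X\<in>carrier ?G. b X Y) (carrier ?G)"
    proof (rule inj_onI)
      fix Y Z assume "Y \<in> carrier ?G" "Z \<in> carrier ?G"
        and eq: "(\<lambda>X\<in>carrier ?G. b X Y) = (\<lambda>X\<in>carrier ?G. b X Z)"
      then obtain y z where yz: "y \<in> M" "z \<in> M" "Y = ?c y" "Z = ?c z" by (auto simp: car)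
      have "mod_Z (\<beta> x y) = mod_Z (\<beta> x z)" if "x \<in> M" for x
        using fun_cong[OF eq, of "?c x"] that yz by (simp add: car b)
      then show "Y = Z" using inj yz c_eq by simp
    qed
    show "(\<lambda>Y. \<lambda>X\<in>carrier ?G. b X Y) ` carrier ?G = hom ?G QZ \<inter> extensional (carrier ?G)"
    proof
      show "(\<lambda>Y. \<lambda>X\<in>carrier ?G. b X Y) ` carrier ?G \<subseteq> hom ?G QZ \<inter> extensional (carrier ?G)"
        using res[OF hom1] by blast
      show "hom ?G QZ \<inter> extensional (carrier ?G) \<subseteq> (\<lambda>Y. \<lambda>X\<in>carrier ?G. b X Y) ` carrier ?G"
      proof
        fix \<chi> assume \<chi>: "\<chi> \<in> hom ?G QZ \<inter> extensional (carrier ?G)"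
        then obtain Y where "Y \<in> carrier ?G" "\<forall>X\<in>carrier ?G. \<chi> X = b X Y" using surj by blast
        moreover from this have "\<chi> = (\<lambda>X\<in>carrier ?G. b X Y)"
          using \<chi> by (intro extensionalityI[where A = "carrier ?G"]) auto
        ultimately show "\<chi> \<in> (\<lambda>Y. \<lambda>X\<in>carrier ?G. b X Y) ` carrier ?G" by blast
      qed
    qed
  qed
  moreover from this
  have "bij_betw (\<lambda>X. \<lambda>Y\<in>carrier ?G. b X Y) (carrier ?G) (hom ?G QZ \<inter> extensional (carrier ?G))"
  proof -
    interpret G: group ?G by (rule G)
    interpret Q: group QZ by (rule group_QZ)
    \<comment> \<open>By antisymmetry \<open>b X Y = - b Y X = b Y (- X)\<close> in additive
      notation, so this map is the previous one composed with inversion, a bijection of the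
      group.\<close>
    have eq: "(\<lambda>Y\<in>carrier ?G. b X Y) = (\<lambda>Y\<in>carrier ?G. b Y (inv\<^bsub>?G\<^esub> X))" if "X \<in> carrier ?G" for X
    proof (rule restrict_ext)
      fix Y assume Y: "Y \<in> carrier ?G"
      interpret h: group_hom ?G QZ "\<lambda>X. b Y X"
        using hom2[OF Y] by unfold_locales
      show "b X Y = b Y (inv\<^bsub>?G\<^esub> X)" using b_anti[OF that Y] that by simp
    qed
    have "bij_betw (\<lambda>X. inv\<^bsub>?G\<^esub> X) (carrier ?G) (carrier ?G)"
      by (rule bij_betw_byWitness[where f' = "\<lambda>X. inv\<^bsub>?G\<^esub> X"]) auto
    from bij_betw_trans[OF this
        \<open>bij_betw (\<lambda>Y. \<lambda>X\<in>carrier ?G. b X Y) (carrier ?G) (hom ?G QZ \<inter> extensional (carrier ?G))\<close>]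
    show ?thesis by (rule bij_betw_cong[THEN iffD1, rotated]) (simp add: eq)
  qed
  ultimately have "perfect_QZ_pairing ?G b"
    using hom1 hom2 by (simp add: perfect_QZ_pairing_def QZ_pairing_def)
  moreover have "antisymmetric_QZ_pairing ?G b"
    unfolding antisymmetric_QZ_pairing_def using b_anti by blast
  ultimately show ?thesis using b that by blast
qed

section \<open>Characters of subgroups of a lattice\<close>

text \<open>A homomorphism from a subgroup of the module to rationals modulo integers is encoded by its
  graph \<open>R\<close>, a subgroup of the product with the rationals whose fibre over \<open>0\<close> consists of integers.\<close>

lemma (in module) graph_int_multiple_closed:
  fixes R :: "('b \<times> rat) set"
  assumes "add_subgroup R" "(v, q) \<in> R"
  shows "(of_int k *s v, of_int k * q) \<in> R"
proof -
  have nat: "(of_nat n *s v, of_nat n * q) \<in> R" for n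
  proof (induction n)
    case 0
    then show ?case using add_subgroup_zero[OF assms(1)] by (simp add: zero_prod_def)
  next
    case (Suc n)
    then show ?case
      using add_subgroup_add[OF assms(1,2)] by (fastforce simp: scale_left_distrib algebra_simps)
  qed
  show ?thesis
  proof (cases "k \<ge> 0")
    case True
    then show ?thesis using nat[of "nat k"] by simp
  next
    case False
    then show ?thesis using add_subgroup_minus[OF assms(1) nat[of "nat (- k)"]] by simp
  qed
qed

text \<open>\<open>R'\<close> is \<open>R\<close> plus the multiples of \<open>(e, t)\<close>. An
  element of \<open>R'\<close> over \<open>0\<close> compares \<open>k t\<close> with a value that
  \<open>R\<close> already gives to \<open>k e\<close>, and the hypothesis on \<open>t\<close> makes
  the difference an integer. Its case \<open>k = 0\<close> says that \<open>R\<close> itself has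
  integral fibre over \<open>0\<close>.\<close>

lemma (in module) graph_adjoin:
  fixes R :: "('b \<times> rat) set"
  assumes R: "add_subgroup R"
    and t: "\<And>k q. (of_int k *s e, q) \<in> R \<Longrightarrow> q - of_int k * t \<in> \<int>"
  obtains R' where "add_subgroup R'" "R \<subseteq> R'" "(e, t) \<in> R'" "\<And>q. (0, q) \<in> R' \<Longrightarrow> q \<in> \<int>"
proof
  let ?R' = "{r + (of_int k *s e, of_int k * t) | r k. r \<in> R}"
  show "R \<subseteq> ?R'"
  proof
    fix r assume "r \<in> R"
    then show "r \<in> ?R'"
      by (intro CollectI exI[of _ r] exI[of _ 0]) (simp add: zero_prod_def[symmetric])
  qed
  show "(e, t) \<in> ?R'"
    by (intro CollectI exI[of _ 0] exI[of _ 1]) (simp add: add_subgroup_zero[OF R])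
  show "add_subgroup ?R'"
  proof (rule add_subgroupI)
    show "0 \<in> ?R'" using \<open>R \<subseteq> ?R'\<close> add_subgroup_zero[OF R] by blast
    fix x y assume "x \<in> ?R'" "y \<in> ?R'"
    then obtain r k s l where *: "r \<in> R" "s \<in> R" "x = r + (of_int k *s e, of_int k * t)"
      "y = s + (of_int l *s e, of_int l * t)" by blast
    have "x - y = (r - s) + (of_int (k - l) *s e, of_int (k - l) * t)"
      unfolding * by (cases r; cases s) (simp add: algebra_simps scale_left_diff_distrib)
    then show "x - y \<in> ?R'" using add_subgroup_diff[OF R *(1,2)] by blast
  qed
  fix q assume "(0, q) \<in> ?R'"
  then obtain v s k where *: "(v, s) \<in> R" "0 = v + of_int k *s e" "q = s + of_int k * t" by auto
  have "- v = of_int k *s e" using *(2) by (simp add: minus_unique)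
  then have "(of_int k *s e, - s) \<in> R" using add_subgroup_minus[OF R *(1)] by simp
  then show "q \<in> \<int>" using t[of k "- s"] *(3) Ints_minus[of "- s - of_int k * t"]
    by (simp add: add.commute)
qed

text \<open>Divisibility of rationals modulo integers: if \<open>n\<close> generates the integers
  \<open>k\<close> for which \<open>R\<close> has a value at \<open>k e\<close>, and
  \<open>q0\<close> is a value at \<open>n e\<close>, then \<open>t = q0 / n\<close> is compatible
  with \<open>R\<close>.\<close>

lemma (in module) graph_adjoin_ex:
  fixes R :: "('b \<times> rat) set"
  assumes R: "add_subgroup R" and val: "\<And>q. (0, q) \<in> R \<Longrightarrow> q \<in> \<int>"
  obtains R' t where "add_subgroup R'" "R \<subseteq> R'" "(e, t) \<in> R'" "\<And>q. (0, q) \<in> R' \<Longrightarrow> q \<in> \<int>"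
proof -
  have "add_subgroup {k. \<exists>q. (of_int k *s e, q) \<in> R}"
  proof (rule add_subgroupI)
    show "0 \<in> {k. \<exists>q. (of_int k *s e, q) \<in> R}"
      using add_subgroup_zero[OF R] by (auto simp: zero_prod_def)
    fix k l assume "k \<in> {k. \<exists>q. (of_int k *s e, q) \<in> R}" "l \<in> {k. \<exists>q. (of_int k *s e, q) \<in> R}"
    then obtain q r where "(of_int k *s e, q) \<in> R" "(of_int l *s e, r) \<in> R" by blast
    from add_subgroup_diff[OF R this]
    show "k - l \<in> {k. \<exists>q. (of_int k *s e, q) \<in> R}" by (auto simp: scale_left_diff_distrib)
  qed
  then obtain n where "n \<ge> 0" and n: "n \<in> {k. \<exists>q. (of_int k *s e, q) \<in> R}"
      "\<forall>k\<in>{k. \<exists>q. (of_int k *s e, q) \<in> R}. n dvd k"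
    by (rule add_subgroup_int_principal)
  then obtain q0 where q0: "(of_int n *s e, q0) \<in> R" by blast
  \<comment> \<open>Writing \<open>k = n j\<close>, both \<open>q\<close> and \<open>j q0\<close>
    are values at \<open>k e\<close>, hence differ by an integer. If \<open>n = 0\<close>, then
    \<open>k = 0\<close> and \<open>q\<close> lies over \<open>0\<close>; division by zero merely
    sets \<open>t = 0\<close>, and any value would do.\<close>
  have "q - of_int k * (q0 / of_int n) \<in> \<int>" if kq: "(of_int k *s e, q) \<in> R" for k q
  proof -
    obtain j where j: "k = n * j" using n(2) kq by blast
    have "(of_int k *s e, of_int j * q0) \<in> R"
      using graph_int_multiple_closed[OF R q0, of j] by (simp add: j mult.commute)
    from val[of "q - of_int j * q0"] add_subgroup_diff[OF R kq this]
    have int: "q - of_int j * q0 \<in> \<int>" by simp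
    show ?thesis
    proof (cases "n = 0")
      case True
      then show ?thesis using val[of q] kq j by simp
    next
      case False
      then show ?thesis using int by (simp add: j)
    qed
  qed
  from graph_adjoin[OF R this] obtain R' where "add_subgroup R'" "R \<subseteq> R'"
    "(e, q0 / of_int n) \<in> R'" "\<And>q. (0, q) \<in> R' \<Longrightarrow> q \<in> \<int>" by blast
  then show ?thesis by (rule that)
qed

lemma (in module) graph_extend_finite:
  fixes R :: "('b \<times> rat) set"
  assumes "finite E" and R: "add_subgroup R" and val: "\<And>q. (0, q) \<in> R \<Longrightarrow> q \<in> \<int>"
  shows "\<exists>R'. add_subgroup R' \<and> R \<subseteq> R' \<and> (\<forall>e\<in>E. \<exists>t. (e, t) \<in> R') \<and> (\<forall>q. (0, q) \<in> R' \<longrightarrow> q \<in> \<int>)"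
  using assms(1)
proof (induction E)
  case empty
  then show ?case using R val by blast
next
  case (insert e E)
  then obtain R1 where R1: "add_subgroup R1" "R \<subseteq> R1" "\<forall>e\<in>E. \<exists>t. (e, t) \<in> R1"
    "\<And>q. (0, q) \<in> R1 \<Longrightarrow> q \<in> \<int>" by blast
  obtain R2 t where R2: "add_subgroup R2" "R1 \<subseteq> R2" "(e, t) \<in> R2" "\<And>q. (0, q) \<in> R2 \<Longrightarrow> q \<in> \<int>"
    using graph_adjoin_ex[OF R1(1,4), of e] by blast
  have "R \<subseteq> R2" "\<forall>e\<in>insert e E. \<exists>t. (e, t) \<in> R2" using R1(2,3) R2(2,3) by blast+
  with R2(1,4) show ?case by blast
qed

text \<open>The endomorphism \<open>T\<close> sends \<open>u\<close> to the vector whose coordinates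
  in \<open>E\<close> are the numbers \<open>p e u\<close>. Nondegeneracy makes it injective, so
  finite dimension makes it surjective, and arbitrary values on the basis can be prescribed.\<close>

lemma (in finite_dimensional_vector_space) bilinear_form_interpolation:
  fixes p :: "'b \<Rightarrow> 'b \<Rightarrow> 'a"
  assumes E: "finite E" "independent E" "span E = UNIV"
    and lin1: "\<And>y. Vector_Spaces.linear scale (*) (\<lambda>x. p x y)"
    and lin2: "\<And>x. Vector_Spaces.linear scale (*) (\<lambda>y. p x y)"
    and nondeg: "\<And>y. (\<And>x. p x y = 0) \<Longrightarrow> y = 0"
  obtains u where "\<And>e. e \<in> E \<Longrightarrow> p e u = t e"
proof -
  define T where "T u = (\<Sum>e\<in>E. p e u *s e)" for u
  interpret p2: Vector_Spaces.linear scale "(*)" "\<lambda>y. p x y" for x by (rule lin2)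
  interpret p1: Vector_Spaces.linear scale "(*)" "\<lambda>x. p x y" for y by (rule lin1)
  have coeff: "f e = g e" if "(\<Sum>e\<in>E. f e *s e) = (\<Sum>e\<in>E. g e *s e)" "e \<in> E" for f g e
  proof -
    have "(\<Sum>e\<in>E. (f e - g e) *s e) = 0"
      using that(1) by (simp add: scale_left_diff_distrib sum_subtractf)
    from independentD[OF E(2,1) order_refl this that(2)] show ?thesis by simp
  qed
  have lin: "Vector_Spaces.linear scale scale T"
  proof (rule Vector_Spaces.linear_iff[THEN iffD2], intro conjI allI)
    show "vector_space scale" "vector_space scale" by unfold_locales
    show "T (x + y) = T x + T y" for x y
      by (simp add: T_def p2.add scale_left_distrib sum.distrib)
    show "T (c *s x) = c *s T x" for c x
      by (simp add: T_def p2.scale scale_sum_right)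
  qed
  have "inj T"
  proof (rule injI)
    fix x y assume "T x = T y"
    then have e0: "p e (x - y) = 0" if "e \<in> E" for e
      using coeff[of "\<lambda>e. p e x" "\<lambda>e. p e y"] that by (simp add: T_def p2.diff)
    have "p v (x - y) = 0" for v
    proof -
      have "v \<in> span E" by (simp add: E)
      then show ?thesis
        by (rule span_induct_alt) (auto simp: p1.zero p1.add p1.scale e0)
    qed
    then show "x = y" using nondeg[of "x - y"] by simp
  qed
  then have "surj T" using linear_inj_imp_surj lin by blast
  then obtain u where "T u = (\<Sum>e\<in>E. t e *s e)" by (metis surjD)
  then show ?thesis using that[of u] coeff[of "\<lambda>e. p e u" t] by (auto simp: T_def)
qed

section \<open>Lattices stable under an isometry\<close>

locale lattice_isometry =
  finite_dimensional_vector_space scale Basis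
  for scale :: "rat \<Rightarrow> 'v::ab_group_add \<Rightarrow> 'v" and Basis :: "'v set" +
  fixes F D :: "'v \<Rightarrow> 'v" and p :: "'v \<Rightarrow> 'v \<Rightarrow> rat" and \<Lambda> :: "'v set"
  assumes linear_F: "Vector_Spaces.linear scale scale F" and bij_F: "bij F"
    and F_eq: "F = (\<lambda>v. v + D v)"
    and ker_square: "ker (D \<circ> D) = ker D"
    and pairing: "nondegenerate_symmetric_pairing scale p"
    and isometry: "p (F x) (F y) = p x y"
    and lattice: "full_rank_lattice scale \<Lambda>"
    and stable: "F ` \<Lambda> \<subseteq> \<Lambda>"
    and dual_subset: "dual_lattice p \<Lambda> \<subseteq> \<Lambda>"
begin

section \<open>The geometry of \<open>D\<close>: the image is orthogonal to the kernel\<close>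

lemma p_linear_right: "Vector_Spaces.linear scale (*) (\<lambda>y. p x y)"
  and p_linear_left: "Vector_Spaces.linear scale (*) (\<lambda>x. p x y)"
  and p_commute: "p x y = p y x"
  and p_nondegenerate: "(\<And>y. p y x = 0) \<Longrightarrow> x = 0"
  using pairing unfolding nondegenerate_symmetric_pairing_def by metis+

sublocale p_right: Vector_Spaces.linear scale "(*)" "\<lambda>y. p x y" for x
  by (rule p_linear_right)

sublocale p_left: Vector_Spaces.linear scale "(*)" "\<lambda>x. p x y" for y
  by (rule p_linear_left)

lemma F_apply: "F v = v + D v"
  by (simp add: F_eq)

lemma D_apply: "D v = F v - v"
  by (simp add: F_eq)

sublocale D: Vector_Spaces.linear scale scale D
proof -
  interpret F: Vector_Spaces.linear scale scale F by (rule linear_F)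
  show "Vector_Spaces.linear scale scale D"
    by unfold_locales (simp_all add: D_apply F.add F.scale scale_right_diff_distrib)
qed

lemma additive_D: "additive D"
  by (rule additive.intro) (rule D.add)

text \<open>\<open>F\<close> fixes \<open>k\<close>, so
  \<open>p (F v) k = p (F v) (F k) = p v k\<close>, and the difference of the two ends is
  \<open>p (D v) k\<close>.\<close>

lemma range_perp_ker:
  assumes "x \<in> range D" "D k = 0"
  shows "p x k = 0"
proof -
  obtain v where "x = D v" using assms(1) by blast
  then show ?thesis
    using isometry[of v k] assms(2) by (simp add: D_apply[of v] F_apply[of k] p_left.diff)
qed

text \<open>The equality of the kernels of \<open>D \<circ> D\<close> and \<open>D\<close> says that
  \<open>D\<close> is injective on its image. A dimension count then gives surjectivity onto the
  image.\<close>

lemma D_bij_range: "bij_betw D (range D) (range D)"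
proof -
  have sub: "subspace (range D)" using D.subspace_image[OF subspace_UNIV] .
  have inj: "inj_on D (range D)"
  proof (rule inj_onI)
    fix x y assume "x \<in> range D" "y \<in> range D" "D x = D y"
    then obtain u v where uv: "x = D u" "y = D v" "D (D u) = D (D v)" by blast
    then have "u - v \<in> ker (D \<circ> D)" by (simp add: ker_def D.diff)
    then show "x = y" using uv by (simp add: ker_square) (simp add: ker_def D.diff)
  qed
  have "D ` range D = range D"
  proof (rule subspace_dim_equal)
    show "subspace (D ` range D)" using D.subspace_image[OF sub] .
    show "subspace (range D)" by (rule sub)
    show "D ` range D \<subseteq> range D" by blast
    interpret DD: finite_dimensional_vector_space_pair_1 scale Basis scale by unfold_locales
    have "dim (D ` range D) = dim (range D)"
      using sub inj by (intro DD.dim_image_eq D.linear_axioms) (simp add: span_eq_iff[THEN iffD2])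
    then show "dim (range D) \<le> dim (D ` range D)" by simp
  qed
  then show ?thesis using inj by (simp add: bij_betw_def)
qed

text \<open>A rational lift of \<open>D_pairing\<close>: its identities are exact in the rationals
  on the image of \<open>D\<close>, and integers enter only through the lattice.\<close>

definition \<beta> :: "'v \<Rightarrow> 'v \<Rightarrow> rat" where
  "\<beta> x y = p x (inv_into (range D) D y)"

lemma D_pairing_eq: "D_pairing D p x y = mod_Z (\<beta> x y)"
  by (simp add: D_pairing_def \<beta>_def)

text \<open>Two preimages of \<open>D v\<close> differ by an element of the kernel, which is
  orthogonal to \<open>x\<close>. Hence any preimage may replace the one chosen by
  \<open>inv_into\<close>.\<close>

lemma \<beta>_D:
  assumes "x \<in> range D"
  shows "\<beta> x (D v) = p x v"
proof -
  have "D v \<in> D ` range D" using D_bij_range by (simp add: bij_betw_def)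
  then have "D (inv_into (range D) D (D v)) = D v" by (rule f_inv_into_f)
  then have "p x (inv_into (range D) D (D v) - v) = 0"
    using range_perp_ker[OF assms] by (simp add: D.diff)
  then show ?thesis by (simp add: \<beta>_def p_right.diff)
qed

lemma \<beta>_add_right:
  assumes "x \<in> range D" "y \<in> range D" "z \<in> range D"
  shows "\<beta> x (y + z) = \<beta> x y + \<beta> x z"
proof -
  obtain v w where "y = D v" "z = D w" using assms by blast
  then show ?thesis using assms(1) by (simp add: \<beta>_D p_right.add flip: D.add)
qed

lemma \<beta>_add_left: "\<beta> (x + y) z = \<beta> x z + \<beta> y z"
  by (simp add: \<beta>_def p_left.add)

text \<open>For \<open>x = D u\<close> and \<open>y = D w\<close>, the sum is
  \<open>p (D u) w + p (D w) (F u)\<close>. Substituting \<open>D = F - 1\<close> leaves four terms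
  that cancel in pairs by isometry and symmetry.\<close>

lemma \<beta>_F:
  assumes "x \<in> range D" "y \<in> range D"
  shows "\<beta> x y + \<beta> y (F x) = 0"
proof -
  obtain u w where uw: "x = D u" "y = D w" using assms by blast
  have "F x = D (F u)" by (simp add: uw F_apply D.add)
  then have "\<beta> x y + \<beta> y (F x) = p (D u) w + p (D w) (F u)"
    using assms uw by (simp add: \<beta>_D)
  also have "\<dots> = p (F u) w - p u w + (p (F w) (F u) - p w (F u))"
    by (simp add: D_apply p_left.diff)
  also have "\<dots> = 0"
    by (simp add: isometry p_commute[of w])
  finally show ?thesis .
qed

section \<open>The lattice, its dual and the representation of characters by vectors\<close>

lemma add_subgroup_lattice: "add_subgroup \<Lambda>"
proof -
  obtain E where \<Lambda>: "\<Lambda> = {\<Sum>e\<in>E. scale (of_int (c e)) e | c :: 'v \<Rightarrow> int. True}"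
    using lattice unfolding full_rank_lattice_def by blast
  show ?thesis
  proof (rule add_subgroupI)
    show "0 \<in> \<Lambda>" unfolding \<Lambda> by (intro CollectI exI[of _ "\<lambda>_. 0"]) simp
    fix x y assume "x \<in> \<Lambda>" "y \<in> \<Lambda>"
    then obtain c d :: "'v \<Rightarrow> int"
      where "x = (\<Sum>e\<in>E. scale (of_int (c e)) e)" "y = (\<Sum>e\<in>E. scale (of_int (d e)) e)"
      unfolding \<Lambda> by blast
    then have "x - y = (\<Sum>e\<in>E. scale (of_int (c e - d e)) e)"
      by (simp add: scale_left_diff_distrib sum_subtractf)
    then show "x - y \<in> \<Lambda>" unfolding \<Lambda> by (intro CollectI exI[of _ "\<lambda>e. c e - d e"]) simp
  qed
qed

abbreviation dual :: "'v set" where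
  "dual \<equiv> dual_lattice p \<Lambda>"

lemma dualD: "x \<in> dual \<Longrightarrow> l \<in> \<Lambda> \<Longrightarrow> p x l \<in> \<int>"
  by (simp add: dual_lattice_def)

lemma add_subgroup_dual: "add_subgroup dual"
  by (rule add_subgroupI) (auto simp: dual_lattice_def p_left.zero p_left.diff)

lemma add_subgroup_range: "add_subgroup (range D)"
  by (rule add_subgroup_image[OF additive_D]) (simp add: add_subgroup_def)

lemma add_subgroup_image_lattice: "add_subgroup (D ` \<Lambda>)"
  by (rule add_subgroup_image[OF additive_D add_subgroup_lattice])

lemma D_lattice: "l \<in> \<Lambda> \<Longrightarrow> D l \<in> \<Lambda>"
  using add_subgroup_diff[OF add_subgroup_lattice, of "F l" l] stable by (auto simp: D_apply)

text \<open>Every character of a subgroup of \<Lambda> is pairing with a vector: extend it to a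
  lattice basis, then let \<open>u\<close> interpolate the chosen values there.\<close>

lemma graph_represented:
  assumes R: "add_subgroup R" and val: "\<And>q. (0, q) \<in> R \<Longrightarrow> q \<in> \<int>"
  obtains u where "\<And>v q. (v, q) \<in> R \<Longrightarrow> v \<in> \<Lambda> \<Longrightarrow> q - p v u \<in> \<int>"
proof -
  obtain E where E: "finite E" "independent E" "span E = UNIV"
    and \<Lambda>: "\<Lambda> = {\<Sum>e\<in>E. scale (of_int (c e)) e | c :: 'v \<Rightarrow> int. True}"
    using lattice unfolding full_rank_lattice_def by blast
  obtain R' where R': "add_subgroup R'" "R \<subseteq> R'" "\<forall>e\<in>E. \<exists>t. (e, t) \<in> R'" "\<And>q. (0, q) \<in> R' \<Longrightarrow> q \<in> \<int>"
    using graph_extend_finite[OF E(1) R val] by blast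
  then obtain t where t: "\<And>e. e \<in> E \<Longrightarrow> (e, t e) \<in> R'" by metis
  obtain u where u: "\<And>e. e \<in> E \<Longrightarrow> p e u = t e"
    using bilinear_form_interpolation[OF E p_linear_left p_linear_right p_nondegenerate] by blast
  show ?thesis
  proof (rule that)
    fix v q assume vq: "(v, q) \<in> R" "v \<in> \<Lambda>"
    obtain c :: "'v \<Rightarrow> int" where c: "v = (\<Sum>e\<in>E. scale (of_int (c e)) e)"
      using vq(2) \<Lambda> by blast
    \<comment> \<open>Since \<open>v\<close> is an integral combination of \<open>E\<close>, the
      extended graph contains \<open>(v, p v u)\<close>. It also contains \<open>(v, q)\<close>, so
      the difference lies over \<open>0\<close>.\<close>
    have "(\<Sum>e\<in>E. (scale (of_int (c e)) e, of_int (c e) * t e)) \<in> R'"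
      by (intro add_subgroup_sum R' graph_int_multiple_closed t)
    moreover have "(\<Sum>e\<in>E. (scale (of_int (c e)) e, of_int (c e) * t e)) = (v, p v u)"
      using u by (simp add: prod_eq_iff fst_sum snd_sum c p_left.sum p_left.scale)
    ultimately have "(v, p v u) \<in> R'" by simp
    from add_subgroup_diff[OF R'(1) _ this, of "(v, q)"] vq(1) R'(2)
    show "q - p v u \<in> \<int>" using R'(4) by auto
  qed
qed

text \<open>Vanishing on \<open>D ` \<Lambda>\<close> forces the representing vector into \<open>D -` dual\<close> after applying the
  inverse of \<open>F\<close>, because the adjoint of \<open>D\<close> is \<open>- D \<circ> inv F\<close>.\<close>

lemma graph_represented_by_\<beta>:
  assumes R: "add_subgroup R" and val: "\<And>q. (0, q) \<in> R \<Longrightarrow> q \<in> \<int>"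
    and vanish: "\<And>l. l \<in> \<Lambda> \<Longrightarrow> (D l, 0) \<in> R"
  shows "\<exists>y\<in>dual \<inter> range D. \<forall>x q. (x, q) \<in> R \<longrightarrow> x \<in> dual \<inter> range D \<longrightarrow> q - \<beta> x y \<in> \<int>"
proof -
  obtain u where u: "\<And>v q. (v, q) \<in> R \<Longrightarrow> v \<in> \<Lambda> \<Longrightarrow> q - p v u \<in> \<int>"
    using graph_represented[OF R val] by blast
  obtain w where w: "u = F w" using bij_F by (metis bij_pointE)
  have "p (D w) l \<in> \<int>" if l: "l \<in> \<Lambda>" for l
  proof -
    have "p (D l) u = p (F l) (F w) - p l (F w)" by (simp add: D_apply p_left.diff w)
    also have "\<dots> = - p l (D w)" by (simp add: isometry D_apply p_right.diff)
    finally show ?thesis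
      using u[OF vanish[OF l] D_lattice[OF l]] by (simp add: p_commute)
  qed
  then have Dw: "D w \<in> dual" by (simp add: dual_lattice_def)
  show ?thesis
  proof (intro bexI allI impI)
    show "D w \<in> dual \<inter> range D" using Dw by blast
    fix x q assume xq: "(x, q) \<in> R" "x \<in> dual \<inter> range D"
    have "q - p x u \<in> \<int>" using u[OF xq(1)] xq(2) dual_subset by blast
    moreover have "p x (D w) \<in> \<int>" using dualD[of x "D w"] Dw xq(2) dual_subset by blast
    \<comment> \<open>As \<open>u = w + D w\<close>, passing from \<open>p x u\<close> to
      \<open>\<beta> x (D w) = p x w\<close> costs exactly \<open>p x (D w)\<close>, which is
      integral because \<open>D w\<close> lies in the dual and hence in \<Lambda>.\<close>
    moreover have "q - \<beta> x (D w) = (q - p x u) + p x (D w)"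
      using xq(2) by (simp add: \<beta>_D w F_apply[of w] p_right.add)
    ultimately show "q - \<beta> x (D w) \<in> \<int>" by (simp only: Ints_add)
  qed
qed

lemma \<beta>_antisymmetric:
  assumes "x \<in> dual \<inter> range D" "y \<in> dual \<inter> range D"
  shows "\<beta> x y + \<beta> y x \<in> \<int>"
proof -
  have "\<beta> x y + \<beta> y (x + D x) = 0" using \<beta>_F[of x y] assms by (simp add: F_apply)
  then have "\<beta> x y + \<beta> y x = - p y x"
    using assms by (simp add: \<beta>_add_right \<beta>_D)
  moreover have "p y x \<in> \<int>" using assms dual_subset by (intro dualD) auto
  ultimately show ?thesis by simp
qed

lemma \<beta>_integral:
  assumes "x \<in> dual \<inter> range D" "y \<in> dual \<inter> D ` \<Lambda>"
  shows "\<beta> x y \<in> \<int>"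
  using assms by (auto simp: \<beta>_D dualD)

text \<open>The class of \<open>x\<close> modulo \<open>D\<Lambda>\<close> is nonzero, so some
  character of \<open>D\<Lambda> + \<int> x\<close> kills \<open>D\<Lambda>\<close> but not
  \<open>x\<close>. A vector \<open>y\<close> representing that character pairs nontrivially with
  \<open>x\<close>.\<close>

lemma \<beta>_separates:
  assumes x: "x \<in> dual \<inter> range D" "x \<notin> dual \<inter> D ` \<Lambda>"
  shows "\<exists>y\<in>dual \<inter> range D. \<beta> x y \<notin> \<int>"
proof -
  let ?I = "{k. scale (of_int k) x \<in> D ` \<Lambda>}"
  have "add_subgroup ?I"
    using add_subgroup_zero[OF add_subgroup_image_lattice] add_subgroup_diff[OF add_subgroup_image_lattice]
    by (intro add_subgroupI) (auto simp: scale_left_diff_distrib)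
  then obtain n where n: "n \<ge> 0" "n \<in> ?I" "\<forall>k\<in>?I. n dvd k"
    by (rule add_subgroup_int_principal)
  have "n \<noteq> 1" using n(2) x by auto
  \<comment> \<open>\<open>n\<close> is the order of \<open>x\<close> modulo
    \<open>D\<Lambda>\<close>, so \<open>1 / n\<close> is an admissible value, nonintegral because
    \<open>n \<noteq> 1\<close>. For infinite order any nonintegral value is admissible, here
    \<open>1 / 2\<close>.\<close>
  define t :: rat where "t = (if n = 0 then 1 / 2 else 1 / of_int n)"
  have inverse_not_int: "1 / of_int m \<notin> (\<int> :: rat set)" if "m > 1" for m :: int
  proof
    assume "1 / of_int m \<in> (\<int> :: rat set)"
    then obtain j where "1 / of_int m = (of_int j :: rat)" by (auto elim: Ints_cases)
    then have "of_int (j * m) = (1 :: rat)" using that by (simp add: field_simps)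
    then have "j * m = 1" by (simp only: of_int_eq_1_iff)
    then show False using that by (auto simp: zmult_eq_1_iff)
  qed
  have t: "t \<notin> \<int>"
    using inverse_not_int[of 2] inverse_not_int[of n] n(1) \<open>n \<noteq> 1\<close> by (auto simp: t_def)
  let ?R = "D ` \<Lambda> \<times> {0 :: rat}"
  have R: "add_subgroup ?R"
    using add_subgroup_zero[OF add_subgroup_image_lattice] add_subgroup_diff[OF add_subgroup_image_lattice]
    by (intro add_subgroupI) (auto simp: zero_prod_def)
  have "q - of_int k * t \<in> \<int>" if kq: "(scale (of_int k) x, q) \<in> ?R" for k q
  proof -
    obtain j where "k = n * j" using n(3) kq by blast
    then show ?thesis using kq by (cases "n = 0") (auto simp: t_def)
  qed
  from graph_adjoin[OF R this] obtain R' where R': "add_subgroup R'" "?R \<subseteq> R'" "(x, t) \<in> R'"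
    "\<And>q. (0, q) \<in> R' \<Longrightarrow> q \<in> \<int>" by blast
  have "(D l, 0) \<in> R'" if "l \<in> \<Lambda>" for l using R'(2) that by blast
  from graph_represented_by_\<beta>[OF R'(1,4) this]
  have "\<exists>y\<in>dual \<inter> range D. \<forall>x q. (x, q) \<in> R' \<longrightarrow> x \<in> dual \<inter> range D \<longrightarrow> q - \<beta> x y \<in> \<int>" .
  then obtain y where y: "y \<in> dual \<inter> range D" "t - \<beta> x y \<in> \<int>" using R'(3) x(1) by blast
  then have "\<beta> x y \<notin> \<int>" using t Ints_add[of "t - \<beta> x y" "\<beta> x y"] by auto
  then show ?thesis using y(1) by blast
qed

text \<open>The character \<open>g\<close> on the dual part and the zero character on
  \<open>D\<Lambda>\<close> agree modulo integers on the intersection, so they glue to a character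
  of the sum that vanishes on \<open>D\<Lambda>\<close> and is therefore represented by some
  \<open>y\<close>.\<close>

lemma \<beta>_represents:
  assumes add: "\<And>x y. x \<in> dual \<inter> range D \<Longrightarrow> y \<in> dual \<inter> range D \<Longrightarrow> g (x + y) - (g x + g y) \<in> \<int>"
    and int: "\<And>x. x \<in> dual \<inter> D ` \<Lambda> \<Longrightarrow> g x \<in> \<int>"
  shows "\<exists>y\<in>dual \<inter> range D. \<forall>x\<in>dual \<inter> range D. g x - \<beta> x y \<in> \<int>"
proof -
  let ?M = "dual \<inter> range D"
  have M: "add_subgroup ?M" using add_subgroup_dual add_subgroup_range by (rule add_subgroup_Int)
  \<comment> \<open>All rational lifts of the values of \<open>g\<close> are included, so that
    \<open>?A\<close> is a subgroup although \<open>g\<close> is additive only modulo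
    integers.\<close>
  let ?A = "{(x, q). x \<in> ?M \<and> q - g x \<in> \<int>}"
  let ?B = "D ` \<Lambda> \<times> {0 :: rat}"
  have B: "add_subgroup ?B"
    using add_subgroup_zero[OF add_subgroup_image_lattice] add_subgroup_diff[OF add_subgroup_image_lattice]
    by (intro add_subgroupI) (auto simp: zero_prod_def)
  have g0: "g 0 \<in> \<int>"
    by (rule int) (simp add: add_subgroup_zero add_subgroup_dual add_subgroup_image_lattice)
  have A: "add_subgroup ?A"
  proof (rule add_subgroupI)
    show "0 \<in> ?A" using add_subgroup_zero[OF M] g0 by (simp add: zero_prod_def)
    fix a b assume "a \<in> ?A" "b \<in> ?A"
    then obtain x q y r where *: "a = (x, q)" "b = (y, r)" "x \<in> ?M" "y \<in> ?M"
      "q - g x \<in> \<int>" "r - g y \<in> \<int>" by auto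
    have xy: "x - y \<in> ?M" using M *(3,4) by (rule add_subgroup_diff)
    have "g x - (g (x - y) + g y) \<in> \<int>" using add[OF xy *(4)] by simp
    from Ints_add[OF Ints_diff[OF *(5,6)] this]
    have "(q - g x) - (r - g y) + (g x - (g (x - y) + g y)) \<in> \<int>" .
    then show "a - b \<in> ?A" using xy * by (simp add: algebra_simps)
  qed
  have AB: "add_subgroup (?A + ?B)" using A B by (rule add_subgroup_plus)
  have "q \<in> \<int>" if q: "(0, q) \<in> ?A + ?B" for q
  proof -
    obtain a b where ab: "(0, q) = a + b" "a \<in> ?A" "b \<in> ?B" using q by (rule set_plus_elim)
    obtain x where x: "a = (x, q)" "x \<in> ?M" "q - g x \<in> \<int>" using ab by force
    obtain l where l: "l \<in> \<Lambda>" "x + D l = 0" using ab x(1) by auto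
    \<comment> \<open>An element over \<open>0\<close> forces \<open>x\<close> into the intersection
      of the two domains, where \<open>g\<close> is integral by hypothesis.\<close>
    have "x = D (- l)" using l(2) by (simp add: D.neg eq_neg_iff_add_eq_0)
    then have "g x \<in> \<int>"
      using x(2) add_subgroup_minus[OF add_subgroup_lattice l(1)] by (intro int) blast
    then show ?thesis using Ints_add[OF x(3)] by simp
  qed
  moreover have "(D l, 0) \<in> ?A + ?B" if "l \<in> \<Lambda>" for l
    using set_plus_intro[OF add_subgroup_zero[OF A], of "(D l, 0)" ?B] that by simp
  ultimately have "\<exists>y\<in>?M. \<forall>x q. (x, q) \<in> ?A + ?B \<longrightarrow> x \<in> ?M \<longrightarrow> q - \<beta> x y \<in> \<int>"
    by (rule graph_represented_by_\<beta>[OF AB])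
  then obtain y where y: "y \<in> ?M" "\<forall>x q. (x, q) \<in> ?A + ?B \<longrightarrow> x \<in> ?M \<longrightarrow> q - \<beta> x y \<in> \<int>"
    by blast
  have "(x, g x) \<in> ?A + ?B" if "x \<in> ?M" for x
    using set_plus_intro[OF _ add_subgroup_zero[OF B], of "(x, g x)" ?A] that by simp
  then show ?thesis using y by blast
qed

lemma image_quotient_perfect_pairing:
  obtains b where
    "\<forall>x\<in>dual \<inter> range D. \<forall>y\<in>dual \<inter> range D.
      b (image_coset D \<Lambda> dual x) (image_coset D \<Lambda> dual y) = D_pairing D p x y"
    "perfect_QZ_pairing (image_quotient D \<Lambda> dual) b"
    "antisymmetric_QZ_pairing (image_quotient D \<Lambda> dual) b"
  unfolding image_quotient_def image_coset_def D_pairing_eq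
proof (rule additive_Mod_perfect_pairing[of "dual \<inter> range D" "dual \<inter> D ` \<Lambda>" \<beta>])
  show "add_subgroup (dual \<inter> range D)" "add_subgroup (dual \<inter> D ` \<Lambda>)"
    by (intro add_subgroup_Int add_subgroup_dual add_subgroup_range add_subgroup_image_lattice)+
qed (use \<beta>_antisymmetric \<beta>_integral \<beta>_separates \<beta>_represents in \<open>auto simp: \<beta>_add_right\<close>)

section \<open>Comparison of the two quotients\<close>

lemma add_subgroup_ker: "add_subgroup (ker D)"
  by (rule add_subgroupI) (auto simp: ker_def D.zero D.diff)

lemma add_subgroup_vimage_dual: "add_subgroup (D -` dual)"
  by (rule add_subgroup_vimage[OF additive_D add_subgroup_dual])

lemma ker_subset_vimage_dual: "ker D \<subseteq> D -` dual"
  using add_subgroup_zero[OF add_subgroup_dual] by (auto simp: ker_def)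

lemma group_B_group: "group (B_group D \<Lambda> dual)"
  unfolding B_group_def
  by (intro group_additive_Mod add_subgroup_plus set_plus_mono2 order_refl add_subgroup_lattice
      add_subgroup_ker add_subgroup_vimage_dual ker_subset_vimage_dual)

lemma group_image_quotient: "group (image_quotient D \<Lambda> dual)"
  unfolding image_quotient_def
  by (intro group_additive_Mod add_subgroup_Int add_subgroup_dual add_subgroup_range
      add_subgroup_image_lattice) blast

text \<open>Modulo \<Lambda>, every class has a representative \<open>u\<close> with
  \<open>D u\<close> in the dual. On such representatives \<open>D\<close> has image
  \<open>dual \<inter> range D\<close>, and \<open>D u\<close> lies in \<open>D\<Lambda>\<close>
  exactly when \<open>u\<close> lies in \<open>\<Lambda> + ker D\<close>.\<close>

lemma B_group_iso_image_quotient: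
  obtains \<phi> where "\<phi> \<in> iso (B_group D \<Lambda> dual) (image_quotient D \<Lambda> dual)"
    "\<forall>v\<in>D -` dual. \<phi> (B_coset D \<Lambda> dual v) = image_coset D \<Lambda> dual (D v)"
proof -
  have im: "D ` (D -` dual) = dual \<inter> range D" by (rule image_vimage_eq)
  have iff: "u \<in> \<Lambda> + ker D \<longleftrightarrow> D u \<in> dual \<inter> D ` \<Lambda>" if "u \<in> D -` dual" for u
  proof
    assume "u \<in> \<Lambda> + ker D"
    then show "D u \<in> dual \<inter> D ` \<Lambda>" using that by (auto elim!: set_plus_elim simp: ker_def D.add)
  next
    assume "D u \<in> dual \<inter> D ` \<Lambda>"
    then obtain l where l: "l \<in> \<Lambda>" "D u = D l" by blast
    then have "u - l \<in> ker D" by (simp add: ker_def D.diff)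
    from set_plus_intro[OF l(1) this] show "u \<in> \<Lambda> + ker D" by simp
  qed
  have rep: "\<exists>u\<in>D -` dual. s - u \<in> \<Lambda> + ker D" if s: "s \<in> \<Lambda> + D -` dual" for s
  proof -
    obtain l u where *: "s = l + u" "l \<in> \<Lambda>" "u \<in> D -` dual" using s by (rule set_plus_elim)
    have "s - u \<in> \<Lambda> + ker D"
      using set_plus_intro[OF *(2) add_subgroup_zero[OF add_subgroup_ker]] by (simp add: *(1))
    then show ?thesis using *(3) by blast
  qed
  show ?thesis
  proof (rule additive_Mod_iso[of "\<Lambda> + D -` dual" "\<Lambda> + ker D" "dual \<inter> D ` \<Lambda>" D "D -` dual"])
    show "add_subgroup (\<Lambda> + D -` dual)" "add_subgroup (\<Lambda> + ker D)" "add_subgroup (dual \<inter> D ` \<Lambda>)"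
      by (intro add_subgroup_plus add_subgroup_Int add_subgroup_lattice add_subgroup_vimage_dual
          add_subgroup_ker add_subgroup_dual add_subgroup_image_lattice)+
    show "\<Lambda> + ker D \<subseteq> \<Lambda> + D -` dual"
      by (intro set_plus_mono2 order_refl ker_subset_vimage_dual)
    show "dual \<inter> D ` \<Lambda> \<subseteq> D ` (D -` dual)" unfolding im by blast
    show "D -` dual \<subseteq> \<Lambda> + D -` dual"
      by (rule set_zero_plus2[OF add_subgroup_zero[OF add_subgroup_lattice]])
    fix \<phi> assume "\<phi> \<in> iso (additive_group (\<Lambda> + D -` dual) Mod (\<Lambda> + ker D))
        (additive_group (D ` (D -` dual)) Mod (dual \<inter> D ` \<Lambda>))"
      "\<forall>u\<in>D -` dual. \<phi> ((\<Lambda> + ker D) #>\<^bsub>additive_group (\<Lambda> + D -` dual)\<^esub> u)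
        = (dual \<inter> D ` \<Lambda>) #>\<^bsub>additive_group (D ` (D -` dual))\<^esub> D u"
    then show ?thesis
      unfolding im using that
      by (simp only: B_group_def B_coset_def image_quotient_def image_coset_def)
  qed (fact add_subgroup_vimage_dual additive_D rep iff)+
qed

end

theorem theorem2p3p9:
  fixes scale :: "rat \<Rightarrow> 'v::ab_group_add \<Rightarrow> 'v"
    and Basis :: "'v set"
    and F D :: "'v \<Rightarrow> 'v"
    and p :: "'v \<Rightarrow> 'v \<Rightarrow> rat"
    and \<Lambda> :: "'v set"
  assumes "finite_dimensional_vector_space scale Basis"
    and "Vector_Spaces.linear scale scale F" and "bij F"
    and "F = (\<lambda>v. v + D v)"
    and "ker (D \<circ> D) = ker D"
    and "nondegenerate_symmetric_pairing scale p"
    and "\<And>x y. p (F x) (F y) = p x y"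
    and "full_rank_lattice scale \<Lambda>"
    and "F ` \<Lambda> \<subseteq> \<Lambda>"
    and "dual_lattice p \<Lambda> \<subseteq> \<Lambda>"
  shows "(\<exists>b. perfect_QZ_pairing (B_group D \<Lambda> (dual_lattice p \<Lambda>)) b \<and>
              antisymmetric_QZ_pairing (B_group D \<Lambda> (dual_lattice p \<Lambda>)) b) \<and>
    bij_betw D (range D) (range D) \<and>
    QZ_pairing (additive_group (range D)) (D_pairing D p) \<and>
    (\<forall>x\<in>range D. \<forall>y\<in>range D. D_pairing D p x y \<otimes>\<^bsub>QZ\<^esub> D_pairing D p y (F x) = \<one>\<^bsub>QZ\<^esub>) \<and>
    (\<exists>b. (\<forall>x\<in>dual_lattice p \<Lambda> \<inter> range D. \<forall>y\<in>dual_lattice p \<Lambda> \<inter> range D.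
            b (image_coset D \<Lambda> (dual_lattice p \<Lambda>) x) (image_coset D \<Lambda> (dual_lattice p \<Lambda>) y)
              = D_pairing D p x y) \<and>
         perfect_QZ_pairing (image_quotient D \<Lambda> (dual_lattice p \<Lambda>)) b \<and>
         antisymmetric_QZ_pairing (image_quotient D \<Lambda> (dual_lattice p \<Lambda>)) b) \<and>
    (\<exists>\<phi>\<in>iso (B_group D \<Lambda> (dual_lattice p \<Lambda>)) (image_quotient D \<Lambda> (dual_lattice p \<Lambda>)).
       \<forall>v\<in>D -` dual_lattice p \<Lambda>.
         \<phi> (B_coset D \<Lambda> (dual_lattice p \<Lambda>) v) = image_coset D \<Lambda> (dual_lattice p \<Lambda>) (D v))"
proof -
  interpret lattice_isometry scale Basis F D p \<Lambda>
    by (intro lattice_isometry.intro lattice_isometry_axioms.intro) (fact assms)+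
  obtain b where b: "\<forall>x\<in>dual \<inter> range D. \<forall>y\<in>dual \<inter> range D.
      b (image_coset D \<Lambda> dual x) (image_coset D \<Lambda> dual y) = D_pairing D p x y"
    "perfect_QZ_pairing (image_quotient D \<Lambda> dual) b"
    "antisymmetric_QZ_pairing (image_quotient D \<Lambda> dual) b"
    by (rule image_quotient_perfect_pairing)
  obtain \<phi> where \<phi>: "\<phi> \<in> iso (B_group D \<Lambda> dual) (image_quotient D \<Lambda> dual)"
    "\<forall>v\<in>D -` dual. \<phi> (B_coset D \<Lambda> dual v) = image_coset D \<Lambda> dual (D v)"
    by (rule B_group_iso_image_quotient)
  \<comment> \<open>The pairing on the first quotient is the pullback along \<open>\<phi>\<close> of
    the one on the image quotient.\<close>
  have "perfect_QZ_pairing (B_group D \<Lambda> dual) (\<lambda>x y. b (\<phi> x) (\<phi> y))"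
    by (rule perfect_QZ_pairing_iso[OF group_B_group group_image_quotient \<phi>(1) b(2)])
  moreover have "antisymmetric_QZ_pairing (B_group D \<Lambda> dual) (\<lambda>x y. b (\<phi> x) (\<phi> y))"
    using b(3) \<phi>(1) unfolding antisymmetric_QZ_pairing_def
    by (meson Group.iso_iff hom_in_carrier)
  moreover have "QZ_pairing (additive_group (range D)) (D_pairing D p)"
    unfolding QZ_pairing_def D_pairing_eq
    by (auto intro!: homI simp: carrier_QZ mult_QZ \<beta>_add_right \<beta>_add_left)
  moreover have "\<forall>x\<in>range D. \<forall>y\<in>range D.
      D_pairing D p x y \<otimes>\<^bsub>QZ\<^esub> D_pairing D p y (F x) = \<one>\<^bsub>QZ\<^esub>"
    using \<beta>_F by (auto simp: D_pairing_eq mult_QZ one_QZ)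
  ultimately show ?thesis
    using b \<phi> D_bij_range by blast
qed

end
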